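(* Let $g\ge 2$, let $\alpha\colon\pi_g\to F_g$ be the symplectic homomorphism with $\alpha(a_i)=1$ and $\alpha(b_i)=\gamma_i$ for $i\in\{1,\dots,g\}$, and let $\varphi\in\operatorname{Mod}_g(\alpha)$. Then for $i,j\in\{1,\dots,g\}$: (a) $\sharp_{b_i}(\varphi(b_j))=\delta_{ij}$; (b) $\sharp_{b_i}(\varphi(a_j))=0$; (c) $\sharp_{a_j}(\varphi(a_i))=\delta_{ij}$; (d) $M_\varphi=\begin{pmatrix} I_g & A\\ O_g & I_g\end{pmatrix}$ with $I_g,O_g,A\in\mathbb{Z}^{g\times g}$, where $I_g$ is the identity matrix and $O_g$ the zero matrix. In particular, $M_\varphi$ has eigenvalue $1$ with (algebraic) multiplicity $2g$, and $\det(M_\varphi)=1$.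
   Context: $\pi_g=\langle a_1,b_1,\dots,a_g,b_g\mid\prod_{i=1}^g[a_i,b_i]\rangle$ is the fundamental group of a closed oriented surface of genus $g$, and $F_g$ is the free group on $\gamma_1,\dots,\gamma_g$. $\operatorname{Mod}_g$ is the mapping class group of the closed oriented surface of genus $g$, identified with $\operatorname{Out}^+(\pi_g)$ by the Dehn–Nielsen–Baer theorem ($\operatorname{Aut}^+,\operatorname{Out}^+$ denote orientation preserving (outer) automorphisms). $\operatorname{Mod}_g(\alpha)$ is the subgroup of all $\varphi\in\operatorname{Mod}_g$ for which a (equivalently any) representative $\tilde\varphi\in\operatorname{Aut}^+(\pi_g)$ of $\varphi$ satisfies $\alpha\circ\tilde\varphi=c\circ\alpha$ for some inner automorphism $c$ of $F_g$. For $\varphi\in\operatorname{Mod}_g$, viewed as an outer automorphism of $\pi_g$, and generators $s,t\in\{a_1,\dots,a_g,b_1,\dots,b_g\}$, $\sharp_s(\varphi(t))$ denotes the sum of the exponents of $s$ in a word representing $\varphi(t)$ (well defined). $M_\varphi\in\mathbb{Z}^{2g\times 2g}$ is the matrix of the automorphism induced by $\varphi$ on $\pi_g^{ab}\cong\mathbb{Z}^{2g}$ with respect to the basis $(a_1,\dots,a_g,b_1,\dots,b_g)$; its column belonging to $t$ has entries $\sharp_{a_1}(\varphi(t)),\dots,\sharp_{a_g}(\varphi(t)),\sharp_{b_1}(\varphi(t)),\dots,\sharp_{b_g}(\varphi(t))$. *)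

theory Defs
  imports
    "HOL-Algebra.Bij"
    "HOL-Algebra.Generated_Groups"
    "HOL-Algebra.Free_Abelian_Groups"
    "Jordan_Normal_Form.Char_Poly"
begin

section \<open>Groups given by generators and relators\<close>

text \<open>A letter \<open>(x, True)\<close> stands for the generator \<open>x\<close>, and \<open>(x, False)\<close> for its inverse.\<close>

type_synonym 'a word = "('a \<times> bool) list"

definition words :: "'a set \<Rightarrow> 'a word set" where
  "words S = lists (S \<times> UNIV)"

inductive_set pres_rel :: "'a set \<Rightarrow> 'a word set \<Rightarrow> ('a word \<times> 'a word) set"
  for S :: "'a set" and R :: "'a word set" where
  refl: "w \<in> words S \<Longrightarrow> (w, w) \<in> pres_rel S R"
| sym: "(v, w) \<in> pres_rel S R \<Longrightarrow> (w, v) \<in> pres_rel S R"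
| trans: "(u, v) \<in> pres_rel S R \<Longrightarrow> (v, w) \<in> pres_rel S R \<Longrightarrow> (u, w) \<in> pres_rel S R"
| cancel: "u \<in> words S \<Longrightarrow> v \<in> words S \<Longrightarrow> x \<in> S \<Longrightarrow>
    (u @ [(x, e), (x, \<not> e)] @ v, u @ v) \<in> pres_rel S R"
| relator: "u \<in> words S \<Longrightarrow> v \<in> words S \<Longrightarrow> r \<in> R \<Longrightarrow> r \<in> words S \<Longrightarrow>
    (u @ r @ v, u @ v) \<in> pres_rel S R"

definition presented_group :: "'a set \<Rightarrow> 'a word set \<Rightarrow> 'a word set monoid" where
  "presented_group S R =
    \<lparr>carrier = words S // pres_rel S R,
     monoid.mult = (\<lambda>X Y. \<Union>x\<in>X. \<Union>y\<in>Y. pres_rel S R `` {x @ y}),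
     monoid.one = pres_rel S R `` {[]}\<rparr>"

definition pres_gen :: "'a set \<Rightarrow> 'a word set \<Rightarrow> 'a \<Rightarrow> 'a word set" where
  "pres_gen S R x = pres_rel S R `` {[(x, True)]}"

definition expsum :: "'a \<Rightarrow> 'a word \<Rightarrow> int" where
  "expsum s w = (\<Sum>(x, e)\<leftarrow>w. if x = s then (if e then 1 else -1) else 0)"


section \<open>The free group and the surface group\<close>

definition free_grp :: "nat \<Rightarrow> nat word set monoid" where
  "free_grp g = presented_group {1..g} {}"

definition free_gen :: "nat \<Rightarrow> nat \<Rightarrow> nat word set" where
  "free_gen g i = pres_gen {1..g} {} i"

datatype surf_gen = GenA nat | GenB nat

definition surf_gens :: "nat \<Rightarrow> surf_gen set" where
  "surf_gens g = GenA ` {1..g} \<union> GenB ` {1..g}"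

text \<open>The commutator convention is \<open>[a, b] = a b a\<^sup>-\<^sup>1 b\<^sup>-\<^sup>1\<close>.\<close>

definition surf_relator :: "nat \<Rightarrow> surf_gen word" where
  "surf_relator g = concat (map
     (\<lambda>i. [(GenA i, True), (GenB i, True), (GenA i, False), (GenB i, False)]) [1..<Suc g])"

definition surf_grp :: "nat \<Rightarrow> surf_gen word set monoid" where
  "surf_grp g = presented_group (surf_gens g) {surf_relator g}"

definition surf_el :: "nat \<Rightarrow> surf_gen \<Rightarrow> surf_gen word set" where
  "surf_el g t = pres_gen (surf_gens g) {surf_relator g} t"


section \<open>Second integral homology of a group\<close>

text \<open>Boundary maps of the inhomogeneous bar complex (with trivial integral coefficients)
  in degrees 2 and 3; \<open>n\<close>-chains are formal integral combinations of \<open>n\<close>-tuples of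
  group elements.\<close>

definition bar_bd2 :: "('a, 'm) monoid_scheme \<Rightarrow> ('a \<times> 'a \<Rightarrow>\<^sub>0 int) \<Rightarrow> ('a \<Rightarrow>\<^sub>0 int)" where
  "bar_bd2 G = frag_extend (\<lambda>(x, y). frag_of y - frag_of (x \<otimes>\<^bsub>G\<^esub> y) + frag_of x)"

definition bar_bd3 :: "('a, 'm) monoid_scheme \<Rightarrow> ('a \<times> 'a \<times> 'a \<Rightarrow>\<^sub>0 int) \<Rightarrow> ('a \<times> 'a \<Rightarrow>\<^sub>0 int)" where
  "bar_bd3 G = frag_extend (\<lambda>(x, y, z).
     frag_of (y, z) - frag_of (x \<otimes>\<^bsub>G\<^esub> y, z) + frag_of (x, y \<otimes>\<^bsub>G\<^esub> z) - frag_of (x, y))"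

definition trivial_on_H2 :: "('a, 'm) monoid_scheme \<Rightarrow> ('a \<Rightarrow> 'a) \<Rightarrow> bool" where
  "trivial_on_H2 G f \<longleftrightarrow>
    (\<forall>c. Poly_Mapping.keys c \<subseteq> carrier G \<times> carrier G \<and> bar_bd2 G c = 0 \<longrightarrow>
      (\<exists>d. Poly_Mapping.keys d \<subseteq> carrier G \<times> carrier G \<times> carrier G \<and>
        frag_extend (\<lambda>(x, y). frag_of (f x, f y)) c - c = bar_bd3 G d))"


section \<open>The mapping class group\<close>

definition Inn :: "('a, 'm) monoid_scheme \<Rightarrow> ('a \<Rightarrow> 'a) set" where
  "Inn G = (\<lambda>x. \<lambda>y\<in>carrier G. x \<otimes>\<^bsub>G\<^esub> y \<otimes>\<^bsub>G\<^esub> inv\<^bsub>G\<^esub> x) ` carrier G"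

text \<open>As the surface is aspherical, its second homology, an infinite cyclic group generated by
  the fundamental class, is that of its fundamental group. Every automorphism acts on it by
  \<open>1\<close> or \<open>-1\<close>, and it preserves orientation iff it acts by \<open>1\<close>.\<close>

definition Aut_plus :: "nat \<Rightarrow> (surf_gen word set \<Rightarrow> surf_gen word set) monoid" where
  "Aut_plus g = AutoGroup (surf_grp g)
     \<lparr>carrier := {f \<in> auto (surf_grp g). trivial_on_H2 (surf_grp g) f}\<rparr>"

text \<open>The mapping class group as the group of orientation preserving outer automorphisms:
  a mapping class is a coset, that is, the set of all the automorphisms representing it.\<close>

definition Mod_grp :: "nat \<Rightarrow> (surf_gen word set \<Rightarrow> surf_gen word set) set monoid" where
  "Mod_grp g = Aut_plus g Mod Inn (surf_grp g)"

definition Mod_stab ::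
  "nat \<Rightarrow> (surf_gen word set \<Rightarrow> nat word set) \<Rightarrow> (surf_gen word set \<Rightarrow> surf_gen word set) set set"
  where
  "Mod_stab g \<alpha> = {\<phi> \<in> carrier (Mod_grp g).
     \<exists>f\<in>\<phi>. \<exists>c\<in>Inn (free_grp g). \<forall>x\<in>carrier (surf_grp g). \<alpha> (f x) = c (\<alpha> x)}"


section \<open>Exponent sums and the action on the abelianization\<close>

text \<open>The exponent sum of \<open>s\<close> in a word representing \<open>\<phi>(t)\<close>. It depends neither on
  the representative \<open>f\<close> of \<open>\<phi>\<close> nor on the word \<open>w\<close> in the class \<open>f(t)\<close>.\<close>

definition out_expsum ::
  "nat \<Rightarrow> (surf_gen word set \<Rightarrow> surf_gen word set) set \<Rightarrow> surf_gen \<Rightarrow> surf_gen \<Rightarrow> int" where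
  "out_expsum g \<phi> s t = (THE n. \<exists>f\<in>\<phi>. \<exists>w\<in>f (surf_el g t). n = expsum s w)"

definition abelianization :: "('a, 'm) monoid_scheme \<Rightarrow> 'a set monoid" where
  "abelianization G = G Mod derived G (carrier G)"

definition ab_class :: "('a, 'm) monoid_scheme \<Rightarrow> 'a \<Rightarrow> 'a set" where
  "ab_class G x = derived G (carrier G) #>\<^bsub>G\<^esub> x"

text \<open>An automorphism maps the derived subgroup onto itself, so that the image of the coset of
  \<open>x\<close> is the coset of \<open>f x\<close>.\<close>

definition ab_induced :: "('a, 'm) monoid_scheme \<Rightarrow> ('a \<Rightarrow> 'a) \<Rightarrow> 'a set \<Rightarrow> 'a set" where
  "ab_induced G f = (\<lambda>C\<in>carrier (abelianization G). f ` C)"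

text \<open>Matrix indices start at 0: the basis is \<open>a\<^sub>1, \<dots>, a\<^sub>g, b\<^sub>1, \<dots>, b\<^sub>g\<close>,
  in positions \<open>0, \<dots>, 2g - 1\<close>.\<close>

definition surf_basis :: "nat \<Rightarrow> nat \<Rightarrow> surf_gen" where
  "surf_basis g k = (if k < g then GenA (Suc k) else GenB (Suc (k - g)))"

definition out_matrix :: "nat \<Rightarrow> (surf_gen word set \<Rightarrow> surf_gen word set) set \<Rightarrow> int mat" where
  "out_matrix g \<phi> = (THE M. M \<in> carrier_mat (2 * g) (2 * g) \<and>
     (let P = surf_grp g; e = (\<lambda>k. ab_class P (surf_el g (surf_basis g k))) in
      \<forall>f\<in>\<phi>. \<forall>j<2 * g. ab_induced P f (e j) =
        (\<Otimes>\<^bsub>abelianization P\<^esub>i\<in>{..<2 * g}. e i [^]\<^bsub>abelianization P\<^esub> (M $$ (i, j)))))"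

end

theory Submission
  imports Defs
begin

text \<open>
  The exponent sum of a generator is an integer-valued homomorphism on the surface group, because
  every generator has exponent sum \<open>0\<close> in a product of commutators. As \<open>\<int>\<close> is abelian,
  such homomorphisms are blind to inner automorphisms, so they may be evaluated on any automorphism
  \<open>f\<close> representing \<open>\<phi>\<close>.

  Under \<open>\<alpha>\<close> the exponent sum of \<open>\<gamma>\<^sub>i\<close> pulls back to that of
  \<open>b\<^sub>i\<close>, since both take the same values on the generators
  (\<open>class_expsum_symplectic_hom\<close>). Hence \<open>\<alpha> \<circ> f = c \<circ> \<alpha>\<close> with
  \<open>c\<close> inner says that \<open>f\<close> preserves the exponent sum of every \<open>b\<^sub>i\<close>.
  This gives (a) and (b), that is, the lower half of the matrix.

  Part (c) uses that \<open>f\<close> preserves orientation. For homomorphisms \<open>u\<close>, \<open>v\<close> into the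
  integers, \<open>(x, y) \<mapsto> u x * v y\<close> is a 2-cocycle, the cup product of \<open>u\<close> and \<open>v\<close>. It
  vanishes on boundaries, so its value on any 2-cycle \<open>z\<close> is the same as on \<open>f\<close> applied to
  \<open>z\<close> when \<open>f\<close> is trivial on the second homology. Reading the relator as a loop
  gives an explicit cycle, the fundamental class, on which the cup product takes the value
  \<open>\<Sum>k. u a\<^sub>k * v b\<^sub>k - u b\<^sub>k * v a\<^sub>k\<close>. So this intersection form is the same for
  \<open>u \<circ> f\<close>, \<open>v \<circ> f\<close> as for \<open>u\<close>, \<open>v\<close>
  (\<open>trivial_on_H2_preserves_intersection_form\<close>). For \<open>u\<close> the exponent sum of \<open>a\<^sub>j\<close> and
  \<open>v\<close> that of \<open>b\<^sub>i\<close>, which \<open>f\<close> preserves, the first value is the exponent sum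
  of \<open>a\<^sub>j\<close> in \<open>f a\<^sub>i\<close> and the second is \<open>\<delta>\<^sub>i\<^sub>j\<close>.

  For (d), the exponent sums are coordinates on the abelianization: they factor through it and
  separate the classes of the generators, which generate it. The matrix of the induced map is
  therefore the matrix of exponent sums (\<open>out_matrix_eq\<close>). By (a)--(c) it is upper triangular
  with ones on the diagonal, and this determines its characteristic polynomial and determinant.
\<close>

section \<open>Presented groups\<close>

lemma words_Nil [simp]: "[] \<in> words S"
  and words_Cons [simp]: "l # w \<in> words S \<longleftrightarrow> fst l \<in> S \<and> w \<in> words S"
  and words_append [simp]: "v @ w \<in> words S \<longleftrightarrow> v \<in> words S \<and> w \<in> words S"
  by (auto simp: words_def mem_Times_iff)

lemma pres_rel_words: "(v, w) \<in> pres_rel S R \<Longrightarrow> v \<in> words S \<and> w \<in> words S"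
  by (induction rule: pres_rel.induct) auto

lemma equiv_pres_rel: "equiv (words S) (pres_rel S R)"
proof (rule equivI)
  show "pres_rel S R \<subseteq> words S \<times> words S"
    using pres_rel_words by fastforce
  show "refl_on (words S) (pres_rel S R)"
    by (auto simp: refl_on_def intro: pres_rel.refl)
  show "sym (pres_rel S R)"
    by (auto simp: sym_def intro: pres_rel.sym)
  show "Relation.trans (pres_rel S R)"
    by (auto intro: transI pres_rel.trans)
qed

lemma pres_rel_context:
  assumes "(v, w) \<in> pres_rel S R" "a \<in> words S" "b \<in> words S"
  shows "(a @ v @ b, a @ w @ b) \<in> pres_rel S R"
  using assms
proof (induction rule: pres_rel.induct)
  case (cancel u v x e)
  then show ?case
    using pres_rel.cancel[of "a @ u" S "v @ b" x e R] by simp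
next
  case (relator u v r)
  then show ?case
    using pres_rel.relator[of "a @ u" S "v @ b" r R] by simp
qed (auto intro: pres_rel.intros)

lemma pres_rel_append:
  assumes "(v, v') \<in> pres_rel S R" "(w, w') \<in> pres_rel S R"
  shows "(v @ w, v' @ w') \<in> pres_rel S R"
proof -
  have "(v @ w, v' @ w) \<in> pres_rel S R"
    using pres_rel_context[OF assms(1), of "[]" w] pres_rel_words[OF assms(2)] by simp
  moreover have "(v' @ w, v' @ w') \<in> pres_rel S R"
    using pres_rel_context[OF assms(2), of v' "[]"] pres_rel_words[OF assms(1)] by simp
  ultimately show ?thesis
    by (rule pres_rel.trans)
qed

abbreviation word_class :: "'a set \<Rightarrow> 'a word set \<Rightarrow> 'a word \<Rightarrow> 'a word set" where
  "word_class S R w \<equiv> pres_rel S R `` {w}"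

lemma word_class_eq_iff:
  "v \<in> words S \<Longrightarrow> w \<in> words S \<Longrightarrow> word_class S R v = word_class S R w \<longleftrightarrow> (v, w) \<in> pres_rel S R"
  using eq_equiv_class_iff[OF equiv_pres_rel] .

lemma carrier_presented_group: "carrier (presented_group S R) = word_class S R ` words S"
  by (auto simp: presented_group_def quotient_def)

lemma one_presented_group: "\<one>\<^bsub>presented_group S R\<^esub> = word_class S R []"
  by (simp add: presented_group_def)

lemma mult_word_class:
  assumes "v \<in> words S" "w \<in> words S"
  shows "word_class S R v \<otimes>\<^bsub>presented_group S R\<^esub> word_class S R w = word_class S R (v @ w)"
proof -
  have "word_class S R (x @ y) = word_class S R (v @ w)"
    if "x \<in> word_class S R v" "y \<in> word_class S R w" for x y
  proof -
    have "(v @ w, x @ y) \<in> pres_rel S R"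
      using that by (auto intro: pres_rel_append)
    then show ?thesis
      by (metis equiv_class_eq[OF equiv_pres_rel])
  qed
  moreover have "v \<in> word_class S R v" "w \<in> word_class S R w"
    using assms by (auto intro: pres_rel.refl)
  ultimately have "(\<Union>x\<in>word_class S R v. \<Union>y\<in>word_class S R w. word_class S R (x @ y))
      = word_class S R (v @ w)"
    by blast
  then show ?thesis
    by (simp add: presented_group_def)
qed

definition inverse_word :: "'a word \<Rightarrow> 'a word" where
  "inverse_word w = rev (map (\<lambda>(x, e). (x, \<not> e)) w)"

lemma inverse_word_words: "w \<in> words S \<Longrightarrow> inverse_word w \<in> words S"
  by (auto simp: inverse_word_def words_def)

lemma inverse_word_cancel:
  "w \<in> words S \<Longrightarrow> (inverse_word w @ w, []) \<in> pres_rel S R"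
proof (induction w)
  case Nil
  then show ?case by (auto simp: inverse_word_def intro: pres_rel.refl)
next
  case (Cons l w)
  obtain x e where l: "l = (x, e)" by force
  have "inverse_word w \<in> words S" "w \<in> words S" "x \<in> S"
    using Cons.prems inverse_word_words l by auto
  then have "(inverse_word w @ [(x, \<not> e), (x, \<not> \<not> e)] @ w, inverse_word w @ w) \<in> pres_rel S R"
    by (intro pres_rel.cancel)
  then have "(inverse_word (l # w) @ l # w, inverse_word w @ w) \<in> pres_rel S R"
    by (simp add: inverse_word_def l)
  moreover have "(inverse_word w @ w, []) \<in> pres_rel S R"
    using Cons by simp
  ultimately show ?case
    by (rule pres_rel.trans)
qed

lemma group_presented_group: "group (presented_group S R)"
proof (rule groupI)
  show "\<exists>Y\<in>carrier (presented_group S R). Y \<otimes>\<^bsub>presented_group S R\<^esub> X = \<one>\<^bsub>presented_group S R\<^esub>"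
    if X: "X \<in> carrier (presented_group S R)" for X
  proof -
    obtain w where w: "w \<in> words S" "X = word_class S R w"
      using X by (auto simp: carrier_presented_group)
    then have "word_class S R (inverse_word w) \<otimes>\<^bsub>presented_group S R\<^esub> X
        = \<one>\<^bsub>presented_group S R\<^esub>"
      using inverse_word_cancel[of w S R] inverse_word_words[of w S]
      by (simp add: mult_word_class one_presented_group word_class_eq_iff)
    then show ?thesis
      using w inverse_word_words by (auto simp: carrier_presented_group)
  qed
qed (auto simp: carrier_presented_group one_presented_group mult_word_class)

lemma pres_gen_closed [intro]: "x \<in> S \<Longrightarrow> pres_gen S R x \<in> carrier (presented_group S R)"
  by (auto simp: carrier_presented_group pres_gen_def)

lemma inv_pres_gen:
  assumes "x \<in> S"
  shows "inv\<^bsub>presented_group S R\<^esub> pres_gen S R x = word_class S R [(x, False)]"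
proof (rule group.inv_equality[OF group_presented_group])
  have "([(x, False), (x, True)], []) \<in> pres_rel S R"
    using pres_rel.cancel[of "[]" S "[]" x False R] assms by simp
  then show "word_class S R [(x, False)] \<otimes>\<^bsub>presented_group S R\<^esub> pres_gen S R x
      = \<one>\<^bsub>presented_group S R\<^esub>"
    using assms by (simp add: pres_gen_def mult_word_class one_presented_group word_class_eq_iff)
qed (use assms in \<open>auto simp: carrier_presented_group pres_gen_def\<close>)

text \<open>Peeling the first letter off a word reduces its value to the values of letters, so a
  homomorphism is determined on generators.\<close>

lemma hom_presented_group_eqI:
  assumes h: "h \<in> hom (presented_group S R) H" and k: "k \<in> hom (presented_group S R) H"
    and H: "group H"
    and gen: "\<And>x. x \<in> S \<Longrightarrow> h (pres_gen S R x) = k (pres_gen S R x)"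
    and X: "X \<in> carrier (presented_group S R)"
  shows "h X = k X"
proof -
  interpret h: group_hom "presented_group S R" H h
    by (simp add: group_hom.intro group_hom_axioms.intro group_presented_group H h)
  interpret k: group_hom "presented_group S R" H k
    by (simp add: group_hom.intro group_hom_axioms.intro group_presented_group H k)
  have letter: "h (word_class S R [l]) = k (word_class S R [l])" if "fst l \<in> S" for l
  proof (cases l)
    case (Pair x e)
    show ?thesis
    proof (cases e)
      case True
      then show ?thesis using gen[of x] that Pair by (simp add: pres_gen_def)
    next
      case False
      then show ?thesis
        using that Pair gen[of x] pres_gen_closed[of x S R]
        by (simp flip: inv_pres_gen)
    qed
  qed
  have "h (word_class S R w) = k (word_class S R w)" if "w \<in> words S" for w
    using that
  proof (induction w)
    case Nil
    then show ?case
      by (metis one_presented_group h.hom_one k.hom_one)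
  next
    case (Cons l w)
    then have "word_class S R (l # w)
        = word_class S R [l] \<otimes>\<^bsub>presented_group S R\<^esub> word_class S R w"
      by (simp add: mult_word_class)
    moreover have "word_class S R [l] \<in> carrier (presented_group S R)"
      "word_class S R w \<in> carrier (presented_group S R)"
      using Cons.prems by (auto simp: carrier_presented_group)
    ultimately show ?case
      using Cons letter by simp
  qed
  then show ?thesis
    using X by (auto simp: carrier_presented_group)
qed


section \<open>Exponent sums as homomorphisms\<close>

lemma expsum_simps [simp]:
  "expsum s [] = 0"
  "expsum s (l # w) = (if fst l = s then (if snd l then 1 else -1) else 0) + expsum s w"
  "expsum s (v @ w) = expsum s v + expsum s w"
  by (auto simp: expsum_def split: prod.splits)

text \<open>The chosen representative does not matter as soon as every relator has exponent sum
  \<open>0\<close>.\<close>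

definition class_expsum :: "'a \<Rightarrow> 'a word set \<Rightarrow> int" where
  "class_expsum s X = expsum s (SOME w. w \<in> X)"

text \<open>The relators of such a presentation lie in the derived subgroup of the free group, so that
  its abelianization is free abelian on the generators.\<close>

locale balanced_presentation =
  fixes S :: "'a set" and R :: "'a word set"
  assumes balanced: "r \<in> R \<Longrightarrow> expsum s r = 0"
begin

abbreviation G where "G \<equiv> presented_group S R"

lemma expsum_pres_rel: "(v, w) \<in> pres_rel S R \<Longrightarrow> expsum s v = expsum s w"
  by (induction rule: pres_rel.induct) (auto simp: balanced)

lemma class_expsum_word_class:
  assumes "w \<in> words S" shows "class_expsum s (word_class S R w) = expsum s w"
proof -
  have "w \<in> word_class S R w"
    using assms by (auto intro: pres_rel.refl)
  then have "(SOME v. v \<in> word_class S R w) \<in> word_class S R w"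
    by (rule someI)
  then show ?thesis
    by (auto simp: class_expsum_def dest: expsum_pres_rel[of _ _ s])
qed

lemma class_expsum_eq:
  assumes "X \<in> carrier G" "w \<in> X" shows "class_expsum s X = expsum s w"
  using assms by (auto simp: carrier_presented_group class_expsum_word_class dest: expsum_pres_rel)

lemma class_expsum_hom: "class_expsum s \<in> hom G integer_group"
  by (rule homI) (auto simp: carrier_presented_group mult_word_class class_expsum_word_class)

lemma group_hom_class_expsum: "group_hom G integer_group (class_expsum s)"
  by (simp add: group_hom.intro group_hom_axioms.intro group_presented_group class_expsum_hom)

lemma class_expsum_gen:
  "x \<in> S \<Longrightarrow> class_expsum s (pres_gen S R x) = (if x = s then 1 else 0)"
  by (simp add: pres_gen_def class_expsum_word_class)

text \<open>In an abelian target the letters of a word may be sorted. Formally, both sides are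
  homomorphisms in \<open>X\<close> with the same values on the generators.\<close>

lemma hom_to_comm_group_eq_finprod:
  assumes A: "comm_group A" and h: "h \<in> hom G A" and S: "finite S" and X: "X \<in> carrier G"
  shows "h X = (\<Otimes>\<^bsub>A\<^esub>s\<in>S. h (pres_gen S R s) [^]\<^bsub>A\<^esub> class_expsum s X)"
proof (rule hom_presented_group_eqI[OF h _ _ _ X])
  interpret A: comm_group A by (rule A)
  have closed: "h (pres_gen S R s) \<in> carrier A" if "s \<in> S" for s
    using hom_in_carrier[OF h] that by blast
  show "group A" by (rule A.group_axioms)
  show "(\<lambda>X. \<Otimes>\<^bsub>A\<^esub>s\<in>S. h (pres_gen S R s) [^]\<^bsub>A\<^esub> class_expsum s X) \<in> hom G A"
  proof (rule homI)
    fix X Y assume XY: "X \<in> carrier G" "Y \<in> carrier G"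
    have "(\<Otimes>\<^bsub>A\<^esub>s\<in>S. h (pres_gen S R s) [^]\<^bsub>A\<^esub> class_expsum s (X \<otimes>\<^bsub>G\<^esub> Y))
        = (\<Otimes>\<^bsub>A\<^esub>s\<in>S. h (pres_gen S R s) [^]\<^bsub>A\<^esub> class_expsum s X
            \<otimes>\<^bsub>A\<^esub> h (pres_gen S R s) [^]\<^bsub>A\<^esub> class_expsum s Y)"
      using closed
      by (intro A.finprod_cong') (simp_all add: hom_mult[OF class_expsum_hom XY] A.int_pow_mult)
    also have "\<dots> = (\<Otimes>\<^bsub>A\<^esub>s\<in>S. h (pres_gen S R s) [^]\<^bsub>A\<^esub> class_expsum s X)
        \<otimes>\<^bsub>A\<^esub> (\<Otimes>\<^bsub>A\<^esub>s\<in>S. h (pres_gen S R s) [^]\<^bsub>A\<^esub> class_expsum s Y)"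
      using closed by (intro A.finprod_multf) simp_all
    finally show "(\<Otimes>\<^bsub>A\<^esub>s\<in>S. h (pres_gen S R s) [^]\<^bsub>A\<^esub> class_expsum s (X \<otimes>\<^bsub>G\<^esub> Y))
        = (\<Otimes>\<^bsub>A\<^esub>s\<in>S. h (pres_gen S R s) [^]\<^bsub>A\<^esub> class_expsum s X)
        \<otimes>\<^bsub>A\<^esub> (\<Otimes>\<^bsub>A\<^esub>s\<in>S. h (pres_gen S R s) [^]\<^bsub>A\<^esub> class_expsum s Y)" .
  qed (use closed in \<open>simp add: A.finprod_closed\<close>)
  show "h (pres_gen S R x) = (\<Otimes>\<^bsub>A\<^esub>s\<in>S. h (pres_gen S R s) [^]\<^bsub>A\<^esub> class_expsum s (pres_gen S R x))"
    if "x \<in> S" for x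
  proof -
    have "(\<Otimes>\<^bsub>A\<^esub>s\<in>S. h (pres_gen S R s) [^]\<^bsub>A\<^esub> class_expsum s (pres_gen S R x))
        = (\<Otimes>\<^bsub>A\<^esub>s\<in>S. if x = s then h (pres_gen S R s) else \<one>\<^bsub>A\<^esub>)"
      using that closed by (intro A.finprod_cong') (auto simp: class_expsum_gen)
    then show ?thesis
      using that closed S by (simp add: A.finprod_singleton)
  qed
qed

end

lemma hom_finprod_integer_group:
  assumes "comm_group A" "u \<in> hom A integer_group" "f \<in> I \<rightarrow> carrier A" "finite I"
  shows "u (finprod A f I) = (\<Sum>i\<in>I. u (f i))"
proof -
  interpret A: comm_group A by (rule assms)
  interpret u: group_hom A integer_group u
    using assms by (simp add: group_hom.intro group_hom_axioms.intro A.group_axioms)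
  show ?thesis
    using \<open>finite I\<close> \<open>f \<in> I \<rightarrow> carrier A\<close>
    by (induction I rule: finite_induct) (auto simp: Pi_iff)
qed


section \<open>The abelianization\<close>

context group
begin

lemma comm_group_abelianization: "comm_group (abelianization G)"
  by (simp add: abelianization_def derived_quot_is_comm_group)

lemma ab_class_hom: "ab_class G \<in> hom G (abelianization G)"
  using normal.r_coset_hom_Mod[OF derived_self_is_normal]
  by (simp add: abelianization_def ab_class_def[abs_def])

lemma hom_vanishes_on_derived:
  assumes "comm_group H" "h \<in> hom G H" "x \<in> derived G (carrier G)"
  shows "h x = \<one>\<^bsub>H\<^esub>"
proof -
  interpret H: comm_group H by (rule assms)
  interpret h: group_hom G H h
    using assms by (simp add: group_hom.intro group_hom_axioms.intro is_group H.group_axioms)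
  have "h ` derived G (carrier G) = derived H (h ` carrier G)"
    by (simp add: h.derived_img)
  also have "\<dots> = {\<one>\<^bsub>H\<^esub>}"
    by (intro H.derived_eq_singleton) auto
  finally show ?thesis
    using assms by blast
qed

lemma hom_factors_through_abelianization:
  assumes "comm_group H" "h \<in> hom G H"
  obtains u where "u \<in> hom (abelianization G) H"
    and "\<And>x. x \<in> carrier G \<Longrightarrow> u (ab_class G x) = h x"
proof (rule FactGroup_universal[OF assms(2) derived_self_is_normal])
  fix x y
  assume xy: "x \<in> carrier G" "y \<in> carrier G"
    and eq: "derived G (carrier G) #> x = derived G (carrier G) #> y"
  interpret H: comm_group H by (rule assms)
  have "x \<in> derived G (carrier G) #> x"
    using derived_is_subgroup xy by (intro rcos_self) auto
  then obtain d where d: "d \<in> derived G (carrier G)" "x = d \<otimes> y"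
    unfolding eq by (auto simp: r_coset_def)
  moreover have "d \<in> carrier G"
    using d derived_in_carrier[of "carrier G"] by auto
  ultimately show "h x = h y"
    using xy hom_vanishes_on_derived[OF assms d(1)] hom_in_carrier[OF assms(2)]
    by (simp add: hom_mult[OF assms(2)])
qed (use that in \<open>auto simp: abelianization_def ab_class_def\<close>)

text \<open>The image of the coset of \<open>x\<close> is again a coset because an automorphism maps the
  derived subgroup onto itself.\<close>

lemma ab_induced_ab_class:
  assumes f: "f \<in> auto G" and x: "x \<in> carrier G"
  shows "ab_induced G f (ab_class G x) = ab_class G (f x)"
proof -
  have hom: "f \<in> hom G G" and bij: "bij_betw f (carrier G) (carrier G)"
    using f by (auto simp: auto_def Bij_def)
  interpret f: group_hom G G f
    using hom by (simp add: group_hom.intro group_hom_axioms.intro is_group)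
  let ?D = "derived G (carrier G)"
  have sub: "?D \<subseteq> carrier G"
    by (simp add: derived_in_carrier)
  have "f ` ?D = derived G (f ` carrier G)"
    by (simp add: f.derived_img)
  then have "f ` ?D = ?D"
    using bij by (simp add: bij_betw_def)
  moreover have "f ` (?D #> x) = (f ` ?D) #> f x"
  proof -
    have "f (d \<otimes> x) = f d \<otimes> f x" if "d \<in> ?D" for d
      using that sub x by auto
    then show ?thesis
      by (simp add: r_coset_def image_UN)
  qed
  ultimately show ?thesis
    using hom_in_carrier[OF ab_class_hom x]
    by (simp add: ab_induced_def ab_class_def)
qed

end

context balanced_presentation
begin

lemma ab_class_eq_finprod:
  assumes "finite S" "X \<in> carrier G"
  shows "ab_class G X
    = (\<Otimes>\<^bsub>abelianization G\<^esub>s\<in>S. ab_class G (pres_gen S R s) [^]\<^bsub>abelianization G\<^esub> class_expsum s X)"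
  by (intro hom_to_comm_group_eq_finprod assms group.comm_group_abelianization group.ab_class_hom
      group_presented_group)

text \<open>The classes of the generators are independent: the homomorphism induced on the
  abelianization by the exponent sum of \<open>s\<close> reads off the exponent of the class of
  \<open>s\<close>.\<close>

lemma ab_coordinates_unique:
  assumes S: "finite S" and s: "s \<in> S"
    and eq: "(\<Otimes>\<^bsub>abelianization G\<^esub>t\<in>S. ab_class G (pres_gen S R t) [^]\<^bsub>abelianization G\<^esub> (m t :: int))
      = (\<Otimes>\<^bsub>abelianization G\<^esub>t\<in>S. ab_class G (pres_gen S R t) [^]\<^bsub>abelianization G\<^esub> (n t :: int))"
  shows "m s = n s"
proof -
  interpret G: group G by (rule group_presented_group)
  interpret A: comm_group "abelianization G" by (rule G.comm_group_abelianization)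
  obtain u where u: "u \<in> hom (abelianization G) integer_group"
    and u_class: "\<And>X. X \<in> carrier G \<Longrightarrow> u (ab_class G X) = class_expsum s X"
    using G.hom_factors_through_abelianization[OF abelian_integer_group class_expsum_hom[of s]]
    by blast
  have closed: "ab_class G (pres_gen S R t) \<in> carrier (abelianization G)" if "t \<in> S" for t
    using hom_in_carrier[OF G.ab_class_hom] that by blast
  have coordinate:
    "u (\<Otimes>\<^bsub>abelianization G\<^esub>t\<in>S. ab_class G (pres_gen S R t) [^]\<^bsub>abelianization G\<^esub> k t) = k s"
    for k :: "'a \<Rightarrow> int"
  proof -
    have "u (\<Otimes>\<^bsub>abelianization G\<^esub>t\<in>S. ab_class G (pres_gen S R t) [^]\<^bsub>abelianization G\<^esub> k t)
        = (\<Sum>t\<in>S. u (ab_class G (pres_gen S R t) [^]\<^bsub>abelianization G\<^esub> k t))"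
      using closed S by (intro hom_finprod_integer_group A.comm_group_axioms u) auto
    also have "\<dots> = (\<Sum>t\<in>S. if t = s then k t else 0)"
      using closed
      by (intro sum.cong)
        (simp_all add: hom_int_pow[OF u] A.group_axioms u_class class_expsum_gen pres_gen_closed)
    finally show ?thesis
      using S s by simp
  qed
  show ?thesis
    using arg_cong[OF eq, of u] by (simp only: coordinate)
qed

end


section \<open>Cup products and the second homology\<close>

text \<open>The value on a 2-chain of the cochain \<open>(x, y) \<mapsto> u x * v y\<close>. Integers are represented
  as multiples of the one generator \<open>()\<close>, since the linear extension \<^const>\<open>frag_extend\<close> takes
  its values in formal combinations.\<close>

definition cup_eval :: "('a \<Rightarrow> int) \<Rightarrow> ('a \<Rightarrow> int) \<Rightarrow> ('a \<times> 'a \<Rightarrow>\<^sub>0 int) \<Rightarrow> int" where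
  "cup_eval u v c =
    Poly_Mapping.lookup (frag_extend (\<lambda>(x, y). frag_cmul (u x * v y) (frag_of ())) c) ()"

lemma cup_eval_simps [simp]:
  "cup_eval u v 0 = 0"
  "cup_eval u v (frag_of (x, y)) = u x * v y"
  "cup_eval u v (c + d) = cup_eval u v c + cup_eval u v d"
  "cup_eval u v (c - d) = cup_eval u v c - cup_eval u v d"
  by (simp_all add: cup_eval_def frag_extend_add frag_extend_diff lookup_add lookup_minus)

lemma cup_eval_map:
  "cup_eval u v (frag_extend (\<lambda>(x, y). frag_of (f x, f y)) c) = cup_eval (u \<circ> f) (v \<circ> f) c"
proof -
  have "(\<lambda>(x, y). frag_of (f x, f y)) = frag_of \<circ> (\<lambda>(x, y). (f x, f y))"
    by (auto simp: fun_eq_iff)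
  then have "cup_eval u v (frag_extend (\<lambda>(x, y). frag_of (f x, f y)) c)
      = Poly_Mapping.lookup (frag_extend ((\<lambda>(x, y). frag_cmul (u x * v y) (frag_of ())) \<circ>
          (\<lambda>(x, y). (f x, f y))) c) ()"
    by (simp only: cup_eval_def frag_extend_compose)
  then show ?thesis
    by (simp add: cup_eval_def comp_def case_prod_unfold)
qed

context group
begin

text \<open>The cup product of two homomorphisms is a cocycle: the boundary of \<open>(x, y, z)\<close> has
  value \<open>u y * v z - u (x y) * v z + u x * v (y z) - u x * v y\<close>, which cancels by additivity.\<close>

lemma cup_eval_bar_bd3:
  assumes u: "u \<in> hom G integer_group" and v: "v \<in> hom G integer_group"
    and d: "Poly_Mapping.keys d \<subseteq> carrier G \<times> carrier G \<times> carrier G"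
  shows "cup_eval u v (bar_bd3 G d) = 0"
  using d
proof (induction d rule: frag_induction)
  case (one t)
  then show ?case
    by (auto simp: bar_bd3_def hom_mult[OF u] hom_mult[OF v] algebra_simps)
qed (simp_all add: bar_bd3_def frag_extend_diff)

lemma trivial_on_H2_cup_eval:
  assumes "trivial_on_H2 G f"
    and "u \<in> hom G integer_group" "v \<in> hom G integer_group"
    and "Poly_Mapping.keys c \<subseteq> carrier G \<times> carrier G" "bar_bd2 G c = 0"
  shows "cup_eval (u \<circ> f) (v \<circ> f) c = cup_eval u v c"
proof -
  obtain d where d: "Poly_Mapping.keys d \<subseteq> carrier G \<times> carrier G \<times> carrier G"
    and eq: "frag_extend (\<lambda>(x, y). frag_of (f x, f y)) c - c = bar_bd3 G d"
    using assms unfolding trivial_on_H2_def by blast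
  have "cup_eval u v (frag_extend (\<lambda>(x, y). frag_of (f x, f y)) c) - cup_eval u v c
      = cup_eval u v (bar_bd3 G d)"
    by (simp flip: eq)
  then show ?thesis
    using assms d by (simp add: cup_eval_map cup_eval_bar_bd3)
qed

primrec commutator_prod :: "('a \<times> 'a) list \<Rightarrow> 'a" where
  "commutator_prod [] = \<one>"
| "commutator_prod (p # ps) =
    fst p \<otimes> snd p \<otimes> inv (fst p) \<otimes> inv (snd p) \<otimes> commutator_prod ps"

text \<open>The path that starts at \<open>x\<close> and spells the commutators letter by letter is filled by the
  simplices \<open>(p, l)\<close>, for the letters \<open>l\<close> and the values \<open>p\<close> of the prefixes before
  them. The boundary of their sum contains each letter. The letters \<open>a\<close> and \<open>inv a\<close> are
  removed by subtracting \<open>(a, inv a)\<close>, whose boundary is \<open>inv a - \<one> + a\<close>, and likewise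
  for \<open>b\<close>; the two copies of \<open>\<one>\<close> that this adds are removed by subtracting
  \<open>(\<one>, \<one>)\<close> twice, whose boundary is \<open>\<one>\<close>. Only the end points of the path remain, so a
  product of commutators equal to \<open>\<one>\<close> gives a cycle.\<close>

primrec commutator_chain :: "'a \<Rightarrow> ('a \<times> 'a) list \<Rightarrow> ('a \<times> 'a \<Rightarrow>\<^sub>0 int)" where
  "commutator_chain x [] = 0"
| "commutator_chain x (p # ps) = (let a = fst p; b = snd p in
    frag_of (x, a) + frag_of (x \<otimes> a, b) + frag_of (x \<otimes> a \<otimes> b, inv a)
    + frag_of (x \<otimes> a \<otimes> b \<otimes> inv a, inv b)
    - frag_of (a, inv a) - frag_of (b, inv b) - frag_of (\<one>, \<one>) - frag_of (\<one>, \<one>)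
    + commutator_chain (x \<otimes> a \<otimes> b \<otimes> inv a \<otimes> inv b) ps)"

lemma commutator_prod_closed:
  "set ps \<subseteq> carrier G \<times> carrier G \<Longrightarrow> commutator_prod ps \<in> carrier G"
  by (induction ps) auto

lemma keys_commutator_chain:
  "x \<in> carrier G \<Longrightarrow> set ps \<subseteq> carrier G \<times> carrier G \<Longrightarrow>
    Poly_Mapping.keys (commutator_chain x ps) \<subseteq> carrier G \<times> carrier G"
proof (induction ps arbitrary: x)
  case (Cons p ps)
  have add: "Poly_Mapping.keys (c + d) \<subseteq> B" and diff: "Poly_Mapping.keys (c - d) \<subseteq> B"
    if "Poly_Mapping.keys c \<subseteq> B" "Poly_Mapping.keys d \<subseteq> B" for c d :: "'a \<times> 'a \<Rightarrow>\<^sub>0 int" and B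
    using that keys_add[of c d] keys_diff[of c d] by blast+
  have "fst p \<in> carrier G" "snd p \<in> carrier G"
    using Cons.prems by auto
  then show ?case
    unfolding commutator_chain.simps Let_def
    using Cons.prems by (intro add diff Cons.IH) auto
qed simp

lemma bar_bd2_commutator_chain:
  "x \<in> carrier G \<Longrightarrow> set ps \<subseteq> carrier G \<times> carrier G \<Longrightarrow>
    bar_bd2 G (commutator_chain x ps) = frag_of x - frag_of (x \<otimes> commutator_prod ps)"
proof (induction ps arbitrary: x)
  case (Cons p ps)
  obtain a b where p: "p = (a, b)" "a \<in> carrier G" "b \<in> carrier G"
    using Cons.prems by (cases p) auto
  then show ?case
    using Cons commutator_prod_closed[of ps]
    by (simp add: bar_bd2_def frag_extend_add frag_extend_diff Let_def m_assoc)
qed (simp add: bar_bd2_def)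

text \<open>A commutator does not change the value of \<open>u\<close>, and the values of \<open>v\<close> on its four
  letters add up to \<open>0\<close>. So its contribution depends neither on the starting point
  \<open>x\<close> nor on the other commutators, and it is
  \<open>u a * v b - (u a + u b) * v a - u b * v b + u a * v a + u b * v b\<close>.\<close>

lemma cup_eval_commutator_chain:
  assumes u: "u \<in> hom G integer_group" and v: "v \<in> hom G integer_group"
  shows "x \<in> carrier G \<Longrightarrow> set ps \<subseteq> carrier G \<times> carrier G \<Longrightarrow>
    cup_eval u v (commutator_chain x ps) = (\<Sum>(a, b)\<leftarrow>ps. u a * v b - u b * v a)"
proof (induction ps arbitrary: x)
  case (Cons p ps)
  interpret u: group_hom G integer_group u
    using u by (simp add: group_hom.intro group_hom_axioms.intro is_group)
  interpret v: group_hom G integer_group v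
    using v by (simp add: group_hom.intro group_hom_axioms.intro is_group)
  obtain a b where p: "p = (a, b)" "a \<in> carrier G" "b \<in> carrier G"
    using Cons.prems by (cases p) auto
  then show ?case
    using Cons by (simp add: Let_def algebra_simps)
qed simp

lemma trivial_on_H2_preserves_intersection_form:
  assumes f: "f \<in> hom G G" "trivial_on_H2 G f"
    and u: "u \<in> hom G integer_group" and v: "v \<in> hom G integer_group"
    and ps: "set ps \<subseteq> carrier G \<times> carrier G" "commutator_prod ps = \<one>"
  shows "(\<Sum>(a, b)\<leftarrow>ps. u (f a) * v (f b) - u (f b) * v (f a))
    = (\<Sum>(a, b)\<leftarrow>ps. u a * v b - u b * v a)"
proof -
  have "cup_eval (u \<circ> f) (v \<circ> f) (commutator_chain \<one> ps) = cup_eval u v (commutator_chain \<one> ps)"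
    using keys_commutator_chain[of \<one> ps] bar_bd2_commutator_chain[of \<one> ps] ps f
    by (intro trivial_on_H2_cup_eval u v) simp_all
  moreover have "u \<circ> f \<in> hom G integer_group" "v \<circ> f \<in> hom G integer_group"
    using Group.hom_compose[OF f(1)] u v by blast+
  ultimately show ?thesis
    using u v ps by (simp add: cup_eval_commutator_chain)
qed

end


section \<open>Inner automorphisms\<close>

context group
begin

lemma Inn_auto:
  assumes "c \<in> Inn G" shows "c \<in> auto G"
proof -
  obtain x where x: "x \<in> carrier G" and c: "c = (\<lambda>y\<in>carrier G. x \<otimes> y \<otimes> inv x)"
    using assms by (auto simp: Inn_def)
  have "x \<otimes> y \<otimes> inv x \<otimes> (x \<otimes> z \<otimes> inv x) = x \<otimes> (y \<otimes> z) \<otimes> inv x"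
    if "y \<in> carrier G" "z \<in> carrier G" for y z
    using that x by (simp add: m_assoc inv_solve_left')
  then have "c \<in> hom G G"
    using x by (auto intro!: homI simp: c)
  moreover have "bij_betw c (carrier G) (carrier G)"
    using x by (intro bij_betw_byWitness[where f' = "\<lambda>y. inv x \<otimes> y \<otimes> x"])
      (auto simp: c m_assoc, (simp flip: m_assoc)+)
  ultimately show ?thesis
    by (simp add: auto_def Bij_def c)
qed

lemma hom_integer_group_Inn:
  assumes "u \<in> hom G integer_group" "c \<in> Inn G" "y \<in> carrier G"
  shows "u (c y) = u y"
proof -
  interpret u: group_hom G integer_group u
    using assms by (simp add: group_hom.intro group_hom_axioms.intro is_group)
  show ?thesis
    using assms by (auto simp: Inn_def)
qed

lemma compose_auto:
  assumes "c \<in> auto G" "f \<in> auto G" shows "compose (carrier G) c f \<in> auto G"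
  using subgroup.m_closed[OF subgroup_auto assms] assms
  by (simp add: BijGroup_def auto_def)

end


section \<open>The surface group\<close>

lemma finite_surf_gens: "finite (surf_gens g)"
  by (simp add: surf_gens_def)

lemma surf_gens_iff [simp]:
  "GenA i \<in> surf_gens g \<longleftrightarrow> i \<in> {1..g}" "GenB i \<in> surf_gens g \<longleftrightarrow> i \<in> {1..g}"
  by (auto simp: surf_gens_def)

lemma expsum_concat_commutators:
  "expsum s (concat (map (\<lambda>i. [(GenA i, True), (GenB i, True), (GenA i, False), (GenB i, False)]) is)) = 0"
  by (induction "is") auto

interpretation surf: balanced_presentation "surf_gens g" "{surf_relator g}"
  rewrites "presented_group (surf_gens g) {surf_relator g} = surf_grp g"
    and "pres_gen (surf_gens g) {surf_relator g} = surf_el g"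
  for g
  by unfold_locales
    (auto simp: surf_relator_def expsum_concat_commutators surf_grp_def surf_el_def[abs_def])

interpretation free: balanced_presentation "{1..g}" "{}"
  rewrites "presented_group {1..g} {} = free_grp g"
    and "pres_gen {1..g} {} = free_gen g"
  for g :: nat
  by unfold_locales (auto simp: free_grp_def free_gen_def[abs_def])

interpretation surf: group "surf_grp g" for g
  by (simp add: surf_grp_def group_presented_group)

interpretation free: group "free_grp g" for g
  by (simp add: free_grp_def group_presented_group)

lemma surf_el_closed [intro]: "t \<in> surf_gens g \<Longrightarrow> surf_el g t \<in> carrier (surf_grp g)"
  unfolding surf_grp_def surf_el_def by (rule pres_gen_closed)

lemma surf_commutator_prod:
  "surf.commutator_prod g (map (\<lambda>i. (surf_el g (GenA i), surf_el g (GenB i))) [1..<Suc g])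
    = \<one>\<^bsub>surf_grp g\<^esub>"
proof -
  define block where
    "block = (\<lambda>i. [(GenA i, True), (GenB i, True), (GenA i, False), (GenB i, False)])"
  let ?cls = "word_class (surf_gens g) {surf_relator g}"
  have inv: "inv\<^bsub>surf_grp g\<^esub> (surf_el g t) = ?cls [(t, False)]" if "t \<in> surf_gens g" for t
    using inv_pres_gen[OF that] by (simp add: surf_grp_def surf_el_def)
  have el: "surf_el g t = ?cls [(t, True)]" for t
    by (simp add: surf_el_def pres_gen_def)
  have mult: "?cls v \<otimes>\<^bsub>surf_grp g\<^esub> ?cls w = ?cls (v @ w)"
    if "v \<in> words (surf_gens g)" "w \<in> words (surf_gens g)" for v w
    using mult_word_class[OF that] by (simp add: surf_grp_def)
  have words: "concat (map block is) \<in> words (surf_gens g)" if "set is \<subseteq> {1..g}" for "is"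
    using that by (induction "is") (auto simp: block_def)
  have prod: "surf.commutator_prod g (map (\<lambda>i. (surf_el g (GenA i), surf_el g (GenB i))) is)
      = ?cls (concat (map block is))" if "set is \<subseteq> {1..g}" for "is"
    using that
  proof (induction "is")
    case Nil
    then show ?case
      using one_presented_group[of "surf_gens g" "{surf_relator g}", folded surf_grp_def] by simp
  next
    case (Cons i "is")
    have "surf.commutator_prod g (map (\<lambda>i. (surf_el g (GenA i), surf_el g (GenB i))) (i # is))
        = ?cls [(GenA i, True)] \<otimes>\<^bsub>surf_grp g\<^esub> ?cls [(GenB i, True)]
          \<otimes>\<^bsub>surf_grp g\<^esub> ?cls [(GenA i, False)] \<otimes>\<^bsub>surf_grp g\<^esub> ?cls [(GenB i, False)]
          \<otimes>\<^bsub>surf_grp g\<^esub> ?cls (concat (map block is))"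
      using Cons inv[of "GenA i"] inv[of "GenB i"] by (simp add: el)
    also have "\<dots> = ?cls (concat (map block (i # is)))"
      using Cons.prems words[of "is"] by (simp add: mult block_def)
    finally show ?case .
  qed
  have relator: "surf_relator g = concat (map block [1..<Suc g])"
    by (simp only: surf_relator_def block_def)
  have indices: "set [1..<Suc g] \<subseteq> {1..g}"
    by auto
  have "surf.commutator_prod g (map (\<lambda>i. (surf_el g (GenA i), surf_el g (GenB i))) [1..<Suc g])
      = ?cls (surf_relator g)"
    using prod[OF indices] by (simp only: relator[symmetric])
  also have "\<dots> = ?cls []"
  proof -
    have "surf_relator g \<in> words (surf_gens g)"
      unfolding relator by (rule words[OF indices])
    then show ?thesis
      using pres_rel.relator[of "[]" "surf_gens g" "[]" "surf_relator g" "{surf_relator g}"]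
      by (subst word_class_eq_iff) auto
  qed
  also have "\<dots> = \<one>\<^bsub>surf_grp g\<^esub>"
    by (simp add: surf_grp_def one_presented_group)
  finally show ?thesis .
qed

text \<open>The cycle to which the preservation of the intersection form is applied here, given by the
  relator of the surface group, represents the fundamental class of the surface.\<close>

lemma surf_intersection_form_preserved:
  assumes f: "f \<in> hom (surf_grp g) (surf_grp g)" "trivial_on_H2 (surf_grp g) f"
    and u: "u \<in> hom (surf_grp g) integer_group" and v: "v \<in> hom (surf_grp g) integer_group"
  shows "(\<Sum>k = 1..g. u (f (surf_el g (GenA k))) * v (f (surf_el g (GenB k)))
        - u (f (surf_el g (GenB k))) * v (f (surf_el g (GenA k))))
    = (\<Sum>k = 1..g. u (surf_el g (GenA k)) * v (surf_el g (GenB k))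
        - u (surf_el g (GenB k)) * v (surf_el g (GenA k)))"
proof -
  have "set (map (\<lambda>i. (surf_el g (GenA i), surf_el g (GenB i))) [1..<Suc g])
      \<subseteq> carrier (surf_grp g) \<times> carrier (surf_grp g)"
    by (auto simp del: upt_Suc)
  from surf.trivial_on_H2_preserves_intersection_form[OF f u v this surf_commutator_prod]
  show ?thesis
    by (simp add: comp_def interv_sum_list_conv_sum_set_nat atLeastLessThanSuc_atLeastAtMost
        del: upt_Suc)
qed

lemma class_expsum_surf_el [simp]:
  "t \<in> surf_gens g \<Longrightarrow> class_expsum s (surf_el g t) = (if t = s then 1 else 0)"
  by (rule surf.class_expsum_gen)

text \<open>Both sides are homomorphisms in \<open>X\<close> that send \<open>b\<^sub>i\<close> to \<open>1\<close> and the other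
  generators to \<open>0\<close>.\<close>

lemma class_expsum_symplectic_hom:
  assumes "\<alpha> \<in> hom (surf_grp g) (free_grp g)"
    and "\<And>i. i \<in> {1..g} \<Longrightarrow> \<alpha> (surf_el g (GenA i)) = \<one>\<^bsub>free_grp g\<^esub>"
    and "\<And>i. i \<in> {1..g} \<Longrightarrow> \<alpha> (surf_el g (GenB i)) = free_gen g i"
    and X: "X \<in> carrier (surf_grp g)"
  shows "class_expsum i (\<alpha> X) = class_expsum (GenB i) X"
proof -
  have "(class_expsum i \<circ> \<alpha>) X = class_expsum (GenB i) X"
  proof (rule hom_presented_group_eqI[where S = "surf_gens g" and R = "{surf_relator g}"])
    show "class_expsum i \<circ> \<alpha> \<in> hom (presented_group (surf_gens g) {surf_relator g}) integer_group"
      using Group.hom_compose[OF assms(1) free.class_expsum_hom] by (simp add: surf_grp_def)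
    show "class_expsum (GenB i) \<in> hom (presented_group (surf_gens g) {surf_relator g}) integer_group"
      using surf.class_expsum_hom by (simp add: surf_grp_def)
    fix t assume t: "t \<in> surf_gens g"
    have "class_expsum i \<one>\<^bsub>free_grp g\<^esub> = 0"
      using group_hom.hom_one[OF free.group_hom_class_expsum] by simp
    then have "(class_expsum i \<circ> \<alpha>) (surf_el g t) = class_expsum (GenB i) (surf_el g t)"
      using t assms by (cases t) (auto simp: free.class_expsum_gen)
    then show "(class_expsum i \<circ> \<alpha>) (pres_gen (surf_gens g) {surf_relator g} t)
        = class_expsum (GenB i) (pres_gen (surf_gens g) {surf_relator g} t)"
      by (simp add: surf_el_def)
  qed (use X in \<open>auto simp: surf_grp_def\<close>)
  then show ?thesis by simp
qed

text \<open>This is the only place where the preservation of orientation enters. The exponent sums of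
  \<open>b\<^sub>i\<close> and \<open>a\<^sub>j\<close> are paired by the intersection form. As \<open>f\<close> preserves
  the former, the pairing after applying \<open>f\<close> is the entry for \<open>a\<^sub>j\<close> and
  \<open>a\<^sub>i\<close>.\<close>

lemma class_expsum_GenA_dual:
  assumes f: "f \<in> hom (surf_grp g) (surf_grp g)" "trivial_on_H2 (surf_grp g) f"
    and B: "\<And>k X. X \<in> carrier (surf_grp g) \<Longrightarrow> class_expsum (GenB k) (f X) = class_expsum (GenB k) X"
    and ij: "i \<in> {1..g}" "j \<in> {1..g}"
  shows "class_expsum (GenA j) (f (surf_el g (GenA i))) = (if i = j then 1 else 0)"
proof -
  have "(\<Sum>k = 1..g. class_expsum (GenA j) (f (surf_el g (GenA k))) * (if k = i then 1 else 0))
      = (\<Sum>k = 1..g. (if k = j then 1 else 0) * (if k = i then 1 else 0))"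
    using surf_intersection_form_preserved[OF f surf.class_expsum_hom surf.class_expsum_hom,
        of "GenA j" "GenB i"]
    by (simp add: B surf_el_closed)
  then show ?thesis
    using ij by (simp add: if_distrib[of "\<lambda>x. _ * x"] cong: if_cong)
qed


section \<open>Mapping classes\<close>

lemma Mod_grp_cases:
  assumes "\<phi> \<in> carrier (Mod_grp g)"
  obtains f\<^sub>0 where "f\<^sub>0 \<in> auto (surf_grp g)" "trivial_on_H2 (surf_grp g) f\<^sub>0"
    and "\<phi> = (\<lambda>c. compose (carrier (surf_grp g)) c f\<^sub>0) ` Inn (surf_grp g)"
proof -
  obtain f\<^sub>0 where f\<^sub>0: "f\<^sub>0 \<in> carrier (Aut_plus g)" and \<phi>: "\<phi> = Inn (surf_grp g) #>\<^bsub>Aut_plus g\<^esub> f\<^sub>0"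
    using assms by (auto simp: Mod_grp_def carrier_FactGroup)
  have auto: "f\<^sub>0 \<in> auto (surf_grp g)" and H2: "trivial_on_H2 (surf_grp g) f\<^sub>0"
    using f\<^sub>0 by (auto simp: Aut_plus_def)
  have "c \<otimes>\<^bsub>Aut_plus g\<^esub> f\<^sub>0 = compose (carrier (surf_grp g)) c f\<^sub>0" if "c \<in> Inn (surf_grp g)" for c
    using surf.Inn_auto[OF that] auto by (simp add: Aut_plus_def AutoGroup_def BijGroup_def auto_def)
  then have "\<phi> = (\<lambda>c. compose (carrier (surf_grp g)) c f\<^sub>0) ` Inn (surf_grp g)"
    by (auto simp: \<phi> r_coset_def)
  with auto H2 show thesis by (rule that)
qed

definition represents :: "nat \<Rightarrow> (surf_gen word set \<Rightarrow> surf_gen word set)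
    \<Rightarrow> (surf_gen word set \<Rightarrow> surf_gen word set) set \<Rightarrow> bool" where
  "represents g f\<^sub>0 \<phi> \<longleftrightarrow> f\<^sub>0 \<in> auto (surf_grp g)
    \<and> \<phi> = (\<lambda>c. compose (carrier (surf_grp g)) c f\<^sub>0) ` Inn (surf_grp g)"

lemma auto_closed: "f \<in> auto H \<Longrightarrow> x \<in> carrier H \<Longrightarrow> f x \<in> carrier H"
  by (auto simp: auto_def hom_def)

lemma represents_auto:
  "represents g f\<^sub>0 \<phi> \<Longrightarrow> f \<in> \<phi> \<Longrightarrow> f \<in> auto (surf_grp g)"
  by (auto simp: represents_def intro: surf.compose_auto surf.Inn_auto)

lemma represents_nonempty: "represents g f\<^sub>0 \<phi> \<Longrightarrow> \<phi> \<noteq> {}"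
  by (auto simp: represents_def Inn_def)

lemma represents_class_expsum:
  assumes "represents g f\<^sub>0 \<phi>" "f \<in> \<phi>" "X \<in> carrier (surf_grp g)"
  shows "class_expsum s (f X) = class_expsum s (f\<^sub>0 X)"
  using assms
  by (auto simp: represents_def compose_def auto_closed surf.hom_integer_group_Inn surf.class_expsum_hom)

lemma out_expsum_eq:
  assumes \<phi>: "represents g f\<^sub>0 \<phi>" and t: "t \<in> surf_gens g"
  shows "out_expsum g \<phi> s t = class_expsum s (f\<^sub>0 (surf_el g t))"
proof -
  have eq: "expsum s w = class_expsum s (f\<^sub>0 (surf_el g t))" if "f \<in> \<phi>" "w \<in> f (surf_el g t)" for f w
  proof -
    have "f (surf_el g t) \<in> carrier (surf_grp g)"
      using represents_auto[OF \<phi> that(1)] t by (auto intro: auto_closed)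
    then show ?thesis
      using surf.class_expsum_eq[OF _ that(2)]
        represents_class_expsum[OF \<phi> that(1) surf_el_closed[OF t], of s]
      by simp
  qed
  obtain f where f: "f \<in> \<phi>"
    using represents_nonempty[OF \<phi>] by blast
  have "f (surf_el g t) \<in> carrier (surf_grp g)"
    using represents_auto[OF \<phi> f] t by (auto intro: auto_closed)
  then obtain w where "w \<in> f (surf_el g t)"
    by (auto simp: surf_grp_def carrier_presented_group intro: pres_rel.refl)
  then show ?thesis
    unfolding out_expsum_def using f eq
    by (intro the_equality) (force, blast)
qed

lemma bij_betw_surf_basis: "bij_betw (surf_basis g) {..<2 * g} (surf_gens g)"
proof (rule bij_betw_byWitness[where f' = "\<lambda>t. case t of GenA i \<Rightarrow> i - 1 | GenB i \<Rightarrow> g + (i - 1)"])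
qed (auto simp: surf_basis_def surf_gens_def)

lemma surf_basis_in_gens: "k < 2 * g \<Longrightarrow> surf_basis g k \<in> surf_gens g"
  using bij_betwE[OF bij_betw_surf_basis] by blast

text \<open>The matrix is defined by its action on the abelianization. The exponent sums give one such
  matrix, and there is no other one since coordinates on the abelianization are unique.\<close>

lemma out_matrix_eq:
  assumes \<phi>: "represents g f\<^sub>0 \<phi>"
  shows "out_matrix g \<phi> = mat (2 * g) (2 * g)
    (\<lambda>(i, j). class_expsum (surf_basis g i) (f\<^sub>0 (surf_el g (surf_basis g j))))" (is "_ = ?M")
proof -
  let ?A = "abelianization (surf_grp g)"
  define e where "e = (\<lambda>k. ab_class (surf_grp g) (surf_el g (surf_basis g k)))"
  interpret A: comm_group ?A by (rule surf.comm_group_abelianization)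
  have closed: "ab_class (surf_grp g) (surf_el g t) \<in> carrier ?A" if "t \<in> surf_gens g" for t
    using hom_in_carrier[OF surf.ab_class_hom] that by blast
  have reindex: "(\<Otimes>\<^bsub>?A\<^esub>i\<in>{..<2 * g}. e i [^]\<^bsub>?A\<^esub> (m (surf_basis g i) :: int))
      = (\<Otimes>\<^bsub>?A\<^esub>t\<in>surf_gens g. ab_class (surf_grp g) (surf_el g t) [^]\<^bsub>?A\<^esub> m t)" for m
    unfolding e_def using bij_betw_surf_basis[of g] closed
    by (intro A.finprod_reindex_bij_betw
        [where g = "\<lambda>t. ab_class (surf_grp g) (surf_el g t) [^]\<^bsub>?A\<^esub> m t"])
      (auto simp: bij_betw_def)
  have col: "ab_induced (surf_grp g) f (e j) = (\<Otimes>\<^bsub>?A\<^esub>i\<in>{..<2 * g}. e i [^]\<^bsub>?A\<^esub> ?M $$ (i, j))"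
    if f: "f \<in> \<phi>" and j: "j < 2 * g" for f j
  proof -
    let ?x = "surf_el g (surf_basis g j)"
    have x: "?x \<in> carrier (surf_grp g)" "f ?x \<in> carrier (surf_grp g)"
      using represents_auto[OF \<phi> f] j by (auto intro: auto_closed surf_basis_in_gens)
    have "ab_induced (surf_grp g) f (e j) = ab_class (surf_grp g) (f ?x)"
      unfolding e_def using represents_auto[OF \<phi> f] x by (simp add: surf.ab_induced_ab_class)
    also have "\<dots> = (\<Otimes>\<^bsub>?A\<^esub>t\<in>surf_gens g.
        ab_class (surf_grp g) (surf_el g t) [^]\<^bsub>?A\<^esub> class_expsum t (f ?x))"
      by (rule surf.ab_class_eq_finprod[OF finite_surf_gens x(2)])
    also have "\<dots> = (\<Otimes>\<^bsub>?A\<^esub>i\<in>{..<2 * g}. e i [^]\<^bsub>?A\<^esub> class_expsum (surf_basis g i) (f ?x))"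
      by (rule reindex[symmetric])
    also have "\<dots> = (\<Otimes>\<^bsub>?A\<^esub>i\<in>{..<2 * g}. e i [^]\<^bsub>?A\<^esub> ?M $$ (i, j))"
      using j closed represents_class_expsum[OF \<phi> f x(1)]
      by (intro A.finprod_cong') (auto simp: e_def surf_basis_in_gens)
    finally show ?thesis .
  qed
  have unique: "N = ?M" if N: "N \<in> carrier_mat (2 * g) (2 * g)"
    and N_col: "\<forall>f\<in>\<phi>. \<forall>j<2 * g. ab_induced (surf_grp g) f (e j)
      = (\<Otimes>\<^bsub>?A\<^esub>i\<in>{..<2 * g}. e i [^]\<^bsub>?A\<^esub> N $$ (i, j))" for N
  proof (rule eq_matI)
    fix i j assume "i < dim_row ?M" "j < dim_col ?M"
    then have i: "i < 2 * g" and j: "j < 2 * g" by auto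
    obtain f where f: "f \<in> \<phi>"
      using represents_nonempty[OF \<phi>] by blast
    \<comment> \<open>Uniqueness of coordinates is stated for exponents indexed by generators, so positions
      in the basis are recovered from generators.\<close>
    define pos where "pos = the_inv_into {..<2 * g} (surf_basis g)"
    have pos: "pos (surf_basis g k) = k" if "k < 2 * g" for k
      using that bij_betw_surf_basis[of g] unfolding pos_def bij_betw_def
      by (intro the_inv_into_f_f) auto
    have expand: "(\<Otimes>\<^bsub>?A\<^esub>t\<in>surf_gens g. ab_class (surf_grp g) (surf_el g t) [^]\<^bsub>?A\<^esub> K $$ (pos t, j))
        = (\<Otimes>\<^bsub>?A\<^esub>i\<in>{..<2 * g}. e i [^]\<^bsub>?A\<^esub> K $$ (i, j))" for K :: "int mat"
      unfolding reindex[symmetric]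
      using closed by (intro A.finprod_cong') (auto simp: pos e_def surf_basis_in_gens)
    have "N $$ (pos (surf_basis g i), j) = ?M $$ (pos (surf_basis g i), j)"
    proof (rule surf.ab_coordinates_unique[OF finite_surf_gens surf_basis_in_gens[OF i],
          where m = "\<lambda>t. N $$ (pos t, j)" and n = "\<lambda>t. ?M $$ (pos t, j)"])
      show "(\<Otimes>\<^bsub>?A\<^esub>t\<in>surf_gens g. ab_class (surf_grp g) (surf_el g t) [^]\<^bsub>?A\<^esub> N $$ (pos t, j))
        = (\<Otimes>\<^bsub>?A\<^esub>t\<in>surf_gens g. ab_class (surf_grp g) (surf_el g t) [^]\<^bsub>?A\<^esub> ?M $$ (pos t, j))"
        unfolding expand by (rule HOL.trans[OF N_col[rule_format, OF f j, symmetric] col[OF f j]])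
    qed
    then show "N $$ (i, j) = ?M $$ (i, j)"
      by (simp add: pos i)
  qed (use N in auto)
  show ?thesis
    unfolding out_matrix_def Let_def
  proof (rule the_equality, goal_cases)
    case 1
    show ?case
      using col unfolding e_def by (intro conjI mat_carrier ballI allI impI)
  next
    case (2 N)
    show ?case
    proof (rule unique)
      show "N \<in> carrier_mat (2 * g) (2 * g)"
        using 2 by (rule conjunct1)
      show "\<forall>f\<in>\<phi>. \<forall>j<2 * g. ab_induced (surf_grp g) f (e j)
          = (\<Otimes>\<^bsub>?A\<^esub>i\<in>{..<2 * g}. e i [^]\<^bsub>?A\<^esub> N $$ (i, j))"
        unfolding e_def using 2 by (rule conjunct2)
    qed
  qed
qed


section \<open>Unipotent upper triangular matrices\<close>

lemma unitriangular:
  fixes M :: "'a :: idom mat"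
  assumes "M \<in> carrier_mat n n" "upper_triangular M" "\<And>i. i < n \<Longrightarrow> M $$ (i, i) = 1"
  shows unitriangular_det: "det M = 1"
    and unitriangular_char_poly: "char_poly M = [:-1, 1:] ^ n"
proof -
  have "diag_mat M = replicate n 1"
    using assms by (auto simp: diag_mat_def intro!: nth_equalityI)
  then show "det M = 1" "char_poly M = [:-1, 1:] ^ n"
    using assms by (simp_all add: det_upper_triangular char_poly_upper_triangular)
qed


section \<open>The action of the stabilizer on the abelianization\<close>

theorem lemma3p1:
  fixes g :: nat
    and \<alpha> :: "surf_gen word set \<Rightarrow> nat word set"
    and \<phi> :: "(surf_gen word set \<Rightarrow> surf_gen word set) set"
  assumes "g \<ge> 2"
    and "\<alpha> \<in> hom (surf_grp g) (free_grp g)"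
    and "\<And>i. i \<in> {1..g} \<Longrightarrow> \<alpha> (surf_el g (GenA i)) = \<one>\<^bsub>free_grp g\<^esub>"
    and "\<And>i. i \<in> {1..g} \<Longrightarrow> \<alpha> (surf_el g (GenB i)) = free_gen g i"
    and "\<phi> \<in> Mod_stab g \<alpha>"
  shows "(\<forall>i\<in>{1..g}. \<forall>j\<in>{1..g}.
            out_expsum g \<phi> (GenB i) (GenB j) = (if i = j then 1 else 0) \<and>
            out_expsum g \<phi> (GenB i) (GenA j) = 0 \<and>
            out_expsum g \<phi> (GenA j) (GenA i) = (if i = j then 1 else 0)) \<and>
         (\<exists>A \<in> carrier_mat g g.
            out_matrix g \<phi> = four_block_mat (1\<^sub>m g) A (0\<^sub>m g g) (1\<^sub>m g)) \<and>
         eigenvalue (map_mat complex_of_int (out_matrix g \<phi>)) 1 \<and>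
         Polynomial.order 1 (char_poly (map_mat complex_of_int (out_matrix g \<phi>))) = 2 * g \<and>
         det (out_matrix g \<phi>) = 1"
proof -
  obtain f\<^sub>0 where f\<^sub>0: "f\<^sub>0 \<in> auto (surf_grp g)" "trivial_on_H2 (surf_grp g) f\<^sub>0"
    and coset: "\<phi> = (\<lambda>c. compose (carrier (surf_grp g)) c f\<^sub>0) ` Inn (surf_grp g)"
    using assms(5) by (auto simp: Mod_stab_def elim: Mod_grp_cases)
  then have \<phi>: "represents g f\<^sub>0 \<phi>"
    by (simp add: represents_def)
  obtain f c where f: "f \<in> \<phi>" and c: "c \<in> Inn (free_grp g)"
    and \<alpha>f: "\<And>X. X \<in> carrier (surf_grp g) \<Longrightarrow> \<alpha> (f X) = c (\<alpha> X)"
    using assms(5) by (auto simp: Mod_stab_def)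
  \<comment> \<open>The representative \<open>f\<close> that commutes with \<open>\<alpha>\<close> up to \<open>c\<close> and the representative
    \<open>f\<^sub>0\<close> that is trivial on the second homology may be different, but they have the same
    exponent sums.\<close>
  have B: "class_expsum (GenB i) (f\<^sub>0 X) = class_expsum (GenB i) X"
    if X: "X \<in> carrier (surf_grp g)" for i X
  proof -
    have fX: "f X \<in> carrier (surf_grp g)"
      using represents_auto[OF \<phi> f] X by (rule auto_closed)
    have "class_expsum (GenB i) (f\<^sub>0 X) = class_expsum (GenB i) (f X)"
      using represents_class_expsum[OF \<phi> f X] by simp
    also have "\<dots> = class_expsum i (c (\<alpha> X))"
      using class_expsum_symplectic_hom[OF assms(2-4) fX] X by (simp add: \<alpha>f)
    also have "\<dots> = class_expsum i (\<alpha> X)"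
      by (rule free.hom_integer_group_Inn[OF free.class_expsum_hom c hom_in_carrier[OF assms(2) X]])
    also have "\<dots> = class_expsum (GenB i) X"
      by (rule class_expsum_symplectic_hom[OF assms(2-4) X])
    finally show ?thesis .
  qed
  have hom: "f\<^sub>0 \<in> hom (surf_grp g) (surf_grp g)"
    using f\<^sub>0 by (simp add: auto_def)
  have abc: "class_expsum (GenB i) (f\<^sub>0 (surf_el g (GenB j))) = (if i = j then 1 else 0)"
      "class_expsum (GenB i) (f\<^sub>0 (surf_el g (GenA j))) = 0"
      "class_expsum (GenA j) (f\<^sub>0 (surf_el g (GenA i))) = (if i = j then 1 else 0)"
    if "i \<in> {1..g}" "j \<in> {1..g}" for i j
    using that class_expsum_GenA_dual[OF hom f\<^sub>0(2) B that] by (auto simp: B surf_el_closed)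
  define A where "A = mat g g (\<lambda>(i, j). class_expsum (GenA (Suc i)) (f\<^sub>0 (surf_el g (GenB (Suc j)))))"
  let ?M = "out_matrix g \<phi>"
  have M: "?M = four_block_mat (1\<^sub>m g) A (0\<^sub>m g g) (1\<^sub>m g)"
  proof (rule eq_matI)
    fix i j
    assume "i < dim_row (four_block_mat (1\<^sub>m g) A (0\<^sub>m g g) (1\<^sub>m g))"
      and "j < dim_col (four_block_mat (1\<^sub>m g) A (0\<^sub>m g g) (1\<^sub>m g))"
    then show "?M $$ (i, j) = four_block_mat (1\<^sub>m g) A (0\<^sub>m g g) (1\<^sub>m g) $$ (i, j)"
      by (auto simp: out_matrix_eq[OF \<phi>] surf_basis_def A_def abc)
  qed (auto simp: out_matrix_eq[OF \<phi>] A_def)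
  have A: "A \<in> carrier_mat g g"
    by (simp add: A_def)
  have dim: "?M \<in> carrier_mat (2 * g) (2 * g)"
    by (simp add: out_matrix_eq[OF \<phi>])
  have tri: "upper_triangular ?M" and diag: "\<And>i. i < 2 * g \<Longrightarrow> ?M $$ (i, i) = 1"
    using A by (auto simp: M intro!: upper_triangularI)
  let ?C = "map_mat complex_of_int ?M"
  have C: "?C \<in> carrier_mat (2 * g) (2 * g)" "\<And>i. i < 2 * g \<Longrightarrow> ?C $$ (i, i) = 1"
    using dim by (simp_all add: diag)
  have "upper_triangular ?C"
    using dim upper_triangularD[OF tri] by (intro upper_triangularI) simp
  have char_poly: "char_poly ?C = [:-1, 1:] ^ (2 * g)"
    by (rule unitriangular_char_poly[OF C(1) \<open>upper_triangular ?C\<close> C(2)])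
  have "eigenvalue ?C 1"
    unfolding eigenvalue_root_char_poly[OF C(1)] char_poly poly_power using assms(1) by simp
  moreover have "Polynomial.order 1 (char_poly ?C) = 2 * g"
    unfolding char_poly by (rule order_power_n_n)
  moreover have "det ?M = 1"
    by (rule unitriangular_det[OF dim tri diag])
  moreover have "\<forall>i\<in>{1..g}. \<forall>j\<in>{1..g}.
      out_expsum g \<phi> (GenB i) (GenB j) = (if i = j then 1 else 0) \<and>
      out_expsum g \<phi> (GenB i) (GenA j) = 0 \<and>
      out_expsum g \<phi> (GenA j) (GenA i) = (if i = j then 1 else 0)"
    by (simp add: out_expsum_eq[OF \<phi>] abc)
  ultimately show ?thesis
    using M A by blast
qed

end
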